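(* The space $\operatorname{Imm}^0(S^1,\mathbb R^2)/\operatorname{Diff}^+(S^1)$ is not contractible.
   Context: For a smooth immersion $c:S^1\to\mathbb R^2$ the (rotation) degree is the winding number of $c':S^1\to\mathbb R^2\setminus\{0\}$ around $0$, where $c$ is viewed as a $2\pi$-periodic function of $\theta$. $\operatorname{Imm}^0(S^1,\mathbb R^2)$ is the space of all smooth immersions $S^1\to\mathbb R^2$ of degree $0$, with the $C^\infty$-topology. $\operatorname{Diff}^+(S^1)$ is the group of orientation preserving smooth diffeomorphisms of $S^1$, acting on $\operatorname{Imm}^0(S^1,\mathbb R^2)$ from the right by reparametrization $c\mapsto c\circ f$. The quotient carries the quotient topology. *)

theory Defs
  imports "HOL-Analysis.Analysis" "HOL-Complex_Analysis.Winding_Numbers"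
begin

text \<open>
  The circle is \<open>\<real> / 2\<pi>\<int>\<close> and the plane is identified with the type \<^typ>\<open>complex\<close>.  Maps from the
  circle to the plane are \<open>2\<pi>\<close>-periodic functions of the angle.
\<close>

definition iter_deriv :: "nat \<Rightarrow> (real \<Rightarrow> 'a::real_normed_vector) \<Rightarrow> real \<Rightarrow> 'a" where
  "iter_deriv k f = ((\<lambda>g t. vector_derivative g (at t)) ^^ k) f"

definition smooth :: "(real \<Rightarrow> 'a::real_normed_vector) \<Rightarrow> bool" where
  "smooth f \<longleftrightarrow> (\<forall>k t. iter_deriv k f differentiable (at t))"

definition smooth_loops :: "(real \<Rightarrow> complex) set" where
  "smooth_loops = {c. smooth c \<and> (\<forall>t. c (t + 2 * pi) = c t)}"

text \<open>
  The \<open>C\<^sup>\<infinity>\<close>-topology, i.e. uniform convergence of the derivatives of every order: the sets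
  of all \<open>d\<close> whose derivatives up to order \<open>n\<close> are uniformly \<open>\<epsilon>\<close>-close to those
  of \<open>c\<close> form a neighbourhood base at \<open>c\<close>.
\<close>

definition Cinf_close :: "nat \<Rightarrow> real \<Rightarrow> (real \<Rightarrow> complex) \<Rightarrow> (real \<Rightarrow> complex) \<Rightarrow> bool" where
  "Cinf_close n \<epsilon> c d \<longleftrightarrow> (\<forall>k\<le>n. \<forall>t. norm (iter_deriv k d t - iter_deriv k c t) < \<epsilon>)"

definition Cinf_topology :: "(real \<Rightarrow> complex) topology" where
  "Cinf_topology = topology (\<lambda>U. U \<subseteq> smooth_loops \<and>
     (\<forall>c\<in>U. \<exists>n. \<exists>\<epsilon>>0. \<forall>d\<in>smooth_loops. Cinf_close n \<epsilon> c d \<longrightarrow> d \<in> U))"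

lemma openin_Cinf_topology:
  "openin Cinf_topology U \<longleftrightarrow> U \<subseteq> smooth_loops \<and>
     (\<forall>c\<in>U. \<exists>n. \<exists>\<epsilon>>0. \<forall>d\<in>smooth_loops. Cinf_close n \<epsilon> c d \<longrightarrow> d \<in> U)"
proof -
  let ?N = "\<lambda>c U. \<exists>n. \<exists>\<epsilon>>0. \<forall>d\<in>smooth_loops. Cinf_close n \<epsilon> c d \<longrightarrow> d \<in> U"
  have inter: "?N c (S \<inter> T)" if "?N c S" "?N c T" for c S T
  proof -
    obtain m e where m: "e > 0" "\<And>d. d \<in> smooth_loops \<Longrightarrow> Cinf_close m e c d \<Longrightarrow> d \<in> S"
      using \<open>?N c S\<close> by blast
    obtain n e' where n: "e' > 0" "\<And>d. d \<in> smooth_loops \<Longrightarrow> Cinf_close n e' c d \<Longrightarrow> d \<in> T"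
      using \<open>?N c T\<close> by blast
    have "Cinf_close m e c d" "Cinf_close n e' c d"
      if "Cinf_close (max m n) (min e e') c d" for d
      using that by (simp_all add: Cinf_close_def)
    moreover have "min e e' > 0" using m n by simp
    ultimately show ?thesis using m(2) n(2) by blast
  qed
  have mono: "?N c T" if "?N c S" "S \<subseteq> T" for c S T
    using that by blast
  have "istopology (\<lambda>U. U \<subseteq> smooth_loops \<and> (\<forall>c\<in>U. ?N c U))"
    unfolding istopology_def
  proof (intro conjI allI impI ballI)
    fix S T c
    assume S: "S \<subseteq> smooth_loops \<and> (\<forall>c\<in>S. ?N c S)" and T: "T \<subseteq> smooth_loops \<and> (\<forall>c\<in>T. ?N c T)"
    assume "c \<in> S \<inter> T"
    with S T show "?N c (S \<inter> T)" by (intro inter) simp_all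
  next
    fix K c
    assume K: "\<forall>S\<in>K. S \<subseteq> smooth_loops \<and> (\<forall>c\<in>S. ?N c S)" and "c \<in> \<Union>K"
    then obtain S where S: "S \<in> K" "c \<in> S" by (elim UnionE)
    from K S have "?N c S" by simp
    then show "?N c (\<Union>K)" by (rule mono) (use S in blast)
  qed auto
  then show ?thesis
    by (simp add: Cinf_topology_def topology_inverse')
qed

lemma topspace_Cinf_topology [simp]: "topspace Cinf_topology = smooth_loops"
proof
  show "topspace Cinf_topology \<subseteq> smooth_loops"
    using openin_topspace[of Cinf_topology] unfolding openin_Cinf_topology by (rule conjunct1)
  have "openin Cinf_topology smooth_loops"
    unfolding openin_Cinf_topology by (intro conjI ballI subset_refl exI[of _ 0] exI[of _ 1]) auto
  then show "smooth_loops \<subseteq> topspace Cinf_topology"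
    by (rule openin_subset)
qed

definition immersions :: "(real \<Rightarrow> complex) set" where
  "immersions = {c \<in> smooth_loops. \<forall>t. vector_derivative c (at t) \<noteq> 0}"

text \<open>
  Paths in the library are parametrised by \<open>{0..1}\<close>, hence the factor \<open>2\<pi>\<close>.
\<close>

definition rotation_degree :: "(real \<Rightarrow> complex) \<Rightarrow> complex" where
  "rotation_degree c = winding_number (\<lambda>s. vector_derivative c (at (2 * pi * s))) 0"

definition Imm0 :: "(real \<Rightarrow> complex) set" where
  "Imm0 = {c \<in> immersions. rotation_degree c = 0}"

definition Imm0_topology :: "(real \<Rightarrow> complex) topology" where
  "Imm0_topology = subtopology Cinf_topology Imm0"

text \<open>
  Orientation preserving diffeomorphisms of the circle, represented by their lifts to the
  universal cover \<open>\<real>\<close>.  A diffeomorphism has many lifts, differing by multiples of \<open>2\<pi>\<close>;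
  they all act in the same way on periodic functions.
\<close>

definition Diff_plus :: "(real \<Rightarrow> real) set" where
  "Diff_plus = {f. bij f \<and> smooth f \<and> smooth (inv f) \<and> strict_mono f \<and>
                   (\<forall>t. f (t + 2 * pi) = f t + 2 * pi)}"

definition Diff_orbit :: "(real \<Rightarrow> complex) \<Rightarrow> (real \<Rightarrow> complex) set" where
  "Diff_orbit c = {c \<circ> f | f. f \<in> Diff_plus}"

definition quotient_topology :: "'a topology \<Rightarrow> ('a \<Rightarrow> 'b) \<Rightarrow> 'b topology" where
  "quotient_topology X q =
     topology (\<lambda>U. U \<subseteq> q ` topspace X \<and> openin X {x \<in> topspace X. q x \<in> U})"

lemma openin_quotient_topology:
  "openin (quotient_topology X q) U \<longleftrightarrow>
     U \<subseteq> q ` topspace X \<and> openin X {x \<in> topspace X. q x \<in> U}"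
proof -
  have "istopology (\<lambda>U. U \<subseteq> q ` topspace X \<and> openin X {x \<in> topspace X. q x \<in> U})"
    unfolding istopology_def
  proof (intro conjI allI impI)
    fix S T
    assume "S \<subseteq> q ` topspace X \<and> openin X {x \<in> topspace X. q x \<in> S}"
      and "T \<subseteq> q ` topspace X \<and> openin X {x \<in> topspace X. q x \<in> T}"
    moreover have "{x \<in> topspace X. q x \<in> S \<inter> T} =
        {x \<in> topspace X. q x \<in> S} \<inter> {x \<in> topspace X. q x \<in> T}" by blast
    ultimately show "S \<inter> T \<subseteq> q ` topspace X" "openin X {x \<in> topspace X. q x \<in> S \<inter> T}"
      by auto
  next
    fix K
    assume K: "\<forall>S\<in>K. S \<subseteq> q ` topspace X \<and> openin X {x \<in> topspace X. q x \<in> S}"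
    then show "\<Union>K \<subseteq> q ` topspace X" by blast
    have "{x \<in> topspace X. q x \<in> \<Union>K} = (\<Union>S\<in>K. {x \<in> topspace X. q x \<in> S})" by blast
    then show "openin X {x \<in> topspace X. q x \<in> \<Union>K}" using K by auto
  qed
  then show ?thesis
    by (simp add: quotient_topology_def topology_inverse')
qed

lemma topspace_quotient_topology [simp]:
  "topspace (quotient_topology X q) = q ` topspace X"
proof
  show "topspace (quotient_topology X q) \<subseteq> q ` topspace X"
    using openin_topspace[of "quotient_topology X q"] unfolding openin_quotient_topology by (rule conjunct1)
  have "{x \<in> topspace X. q x \<in> q ` topspace X} = topspace X" by blast
  then have "openin (quotient_topology X q) (q ` topspace X)"
    by (simp add: openin_quotient_topology)
  then show "q ` topspace X \<subseteq> topspace (quotient_topology X q)"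
    by (rule openin_subset)
qed

lemma quotient_map_quotient_topology: "quotient_map X (quotient_topology X q) q"
  by (auto simp: quotient_map_def openin_quotient_topology)

end

theory Submission
  imports Defs "HOL-Complex_Analysis.Riemann_Mapping"
begin

text \<open>
  A degree 0 immersion \<open>c\<close> has a continuous tangent angle \<open>a\<close> that is itself \<open>2\<pi>\<close>-periodic, and
  \<open>a\<close> is unique up to adding a multiple of \<open>2\<pi>\<close>.  Being periodic, \<open>a\<close> attains a maximum, and
  the unit vector with angle \<open>max a\<close>, the tangent direction at a place where the tangent has
  turned furthest to the left, does not depend on the choice of \<open>a\<close>.  An orientation preserving
  reparametrisation \<open>f\<close> replaces \<open>a\<close> by \<open>a \<circ> f\<close>, which has the same maximum
  (\<open>top_direction_reparam\<close>), and a \<open>C\<^sup>1\<close>-small change of \<open>c\<close> changes \<open>a\<close> uniformly little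
  (\<open>top_direction_close\<close>).  So this direction is a continuous map from the quotient to the
  unit circle.

  In the other direction, the unit circle maps to the quotient by rotating a figure eight.
  Rotating a curve by an angle \<open>\<phi>\<close> adds \<open>\<phi>\<close> to its tangent angle, so it also rotates its top
  direction by \<open>\<phi>\<close> (\<open>top_direction_figure_eight\<close>).  The composite circle \<open>\<rightarrow>\<close> quotient \<open>\<rightarrow>\<close>
  circle is therefore a rotation, and the circle is a retract of the quotient.  Retracts of contractible spaces are
  contractible, but the circle is not.
\<close>

section \<open>Periodic functions and the derivatives of loops\<close>

lemma periodic_range_eq:
  fixes f :: "real \<Rightarrow> 'a"
  assumes "\<And>t. f (t + 2 * pi) = f t"
  shows "range f = f ` {0..2 * pi}"
proof
  interpret periodic_fun_simple f "2 * pi"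
    by standard (rule assms)
  show "range f \<subseteq> f ` {0..2 * pi}"
  proof clarify
    fix t
    define n where "n = \<lfloor>t / (2 * pi)\<rfloor>"
    have "of_int n \<le> t / (2 * pi)" "t / (2 * pi) \<le> of_int n + 1"
      unfolding n_def by linarith+
    then have "t - of_int n * (2 * pi) \<in> {0..2 * pi}"
      by (simp add: field_simps)
    moreover have "f (t - of_int n * (2 * pi)) = f t"
      by (rule minus_of_int)
    ultimately show "f t \<in> f ` {0..2 * pi}"
      by (metis image_eqI)
  qed
qed auto

lemma compact_range_periodic:
  fixes f :: "real \<Rightarrow> 'a::topological_space"
  assumes "continuous_on UNIV f" and "\<And>t. f (t + 2 * pi) = f t"
  shows "compact (range f)"
  unfolding periodic_range_eq[of f, OF assms(2)]
  by (intro compact_continuous_image continuous_on_subset[OF assms(1)]) auto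

lemma iter_deriv_0 [simp]: "iter_deriv 0 f = f"
  by (simp add: iter_deriv_def)

lemma iter_deriv_Suc: "iter_deriv (Suc k) f = (\<lambda>t. vector_derivative (iter_deriv k f) (at t))"
  by (simp add: iter_deriv_def)

lemma smooth_differentiable: "smooth f \<Longrightarrow> f differentiable (at t)"
  unfolding smooth_def by (metis iter_deriv_0)

lemma smooth_continuous_on_deriv:
  assumes "smooth f"
  shows "continuous_on UNIV (\<lambda>t. vector_derivative f (at t))"
proof -
  have "iter_deriv 1 f differentiable (at t)" for t
    using assms by (simp add: smooth_def)
  then show ?thesis
    by (simp add: iter_deriv_Suc continuous_on_eq_continuous_at differentiable_imp_continuous_within)
qed

lemma deriv_periodic:
  assumes "smooth f" "\<And>t. f (t + p) = f t"
  shows "vector_derivative f (at (t + p)) = vector_derivative f (at t)"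
proof -
  have "(f has_vector_derivative vector_derivative f (at (t + p))) (at (t + p))"
    using smooth_differentiable[OF assms(1)] by (simp add: vector_derivative_works)
  moreover have "((\<lambda>t. t + p) has_vector_derivative 1) (at t)"
    by (auto intro!: derivative_eq_intros)
  ultimately have "(f \<circ> (\<lambda>t. t + p) has_vector_derivative
      (1 *\<^sub>R vector_derivative f (at (t + p)))) (at t)"
    by (intro vector_diff_chain_at)
  then show ?thesis
    using assms(2) by (simp add: o_def vector_derivative_at)
qed

section \<open>Tangent angles\<close>

text \<open>
  Every immersed loop has a continuous angle on the line; one that is periodic, hence bounded,
  exists only in degree 0.
\<close>

definition tangent_angle :: "(real \<Rightarrow> complex) \<Rightarrow> (real \<Rightarrow> real) \<Rightarrow> bool" where
  "tangent_angle c a \<longleftrightarrow> continuous_on UNIV a \<and> (\<forall>t. a (t + 2 * pi) = a t) \<and>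
     (\<forall>t. sgn (vector_derivative c (at t)) = cis (a t))"

text \<open>
  Logarithms of 1 lie in \<open>2\<pi>\<i>\<int>\<close>, so distinct values of \<open>h\<close> are at least \<open>2\<pi>\<close> apart.  With
  \<open>h\<close> the difference of two logarithms of one function, this is their uniqueness up to a constant.
\<close>

lemma constant_if_quantised:
  fixes h :: "real \<Rightarrow> complex"
  assumes "connected S" "continuous_on S h" "\<And>t. t \<in> S \<Longrightarrow> exp (h t) = 1"
  shows "h constant_on S"
proof (rule continuous_discrete_range_constant[OF assms(1,2)])
  fix x assume x: "x \<in> S"
  have "2 * pi \<le> norm (h y - h x)" if y: "y \<in> S" "h y \<noteq> h x" for y
  proof -
    have "exp (h y) = exp (h x)"
      using assms(3) x y by simp
    then obtain n :: int where n: "h y = h x + (of_int (2 * n) * pi) * \<i>"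
      using exp_eq by blast
    with y have "n \<noteq> 0"
      by auto
    then have "1 \<le> \<bar>real_of_int n\<bar>"
      by linarith
    then show ?thesis
      using n by (simp add: norm_mult)
  qed
  then show "\<exists>e>0. \<forall>y. y \<in> S \<and> h y \<noteq> h x \<longrightarrow> e \<le> norm (h y - h x)"
    by (intro exI[of _ "2 * pi"]) auto
qed

text \<open>
  This is where the degree enters.  The derivative has a continuous logarithm \<open>g\<close> on the line,
  and periodicity of the derivative makes \<open>g (t + 2\<pi>) - g t\<close> constant.  That constant is
  \<open>2\<pi>\<i>\<close> times the winding number, hence 0.
\<close>

lemma exists_tangent_angle:
  assumes "c \<in> Imm0"
  obtains a where "tangent_angle c a"
proof -
  let ?c' = "\<lambda>t. vector_derivative c (at t)"
  let ?p = "\<lambda>s. ?c' (2 * pi * s)"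
  have c: "smooth c" "\<And>t. c (t + 2 * pi) = c t" "\<And>t. ?c' t \<noteq> 0"
    and wn: "winding_number ?p 0 = 0"
    using assms by (auto simp: Imm0_def immersions_def smooth_loops_def rotation_degree_def)
  have cont: "continuous_on UNIV ?c'"
    by (rule smooth_continuous_on_deriv[OF c(1)])
  obtain g where g: "continuous_on UNIV g" "\<And>t. ?c' t = exp (g t)"
    using continuous_logarithm_on_contractible[OF cont] c(3)
    by (metis UNIV_I convex_UNIV convex_imp_contractible)
  have "path ?p"
    unfolding path_def by (intro continuous_on_compose2[OF cont] continuous_intros) auto
  moreover have "0 \<notin> path_image ?p"
    using c(3) by (auto simp: path_image_def)
  ultimately obtain q where q: "path q" "pathfinish q - pathstart q = 2 * of_real pi * \<i> * 0"
    "\<And>s. s \<in> {0..1} \<Longrightarrow> ?p s = 0 + exp (q s)"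
    using winding_number_as_continuous_log[of ?p 0] unfolding wn by blast
  have "(\<lambda>s. q s - g (2 * pi * s)) constant_on {0..1}"
  proof (rule constant_if_quantised)
    show "continuous_on {0..1} (\<lambda>s. q s - g (2 * pi * s))"
      using q(1) unfolding path_def
      by (intro continuous_intros continuous_on_compose2[OF g(1)]) auto
    show "exp (q s - g (2 * pi * s)) = 1" if "s \<in> {0..1}" for s
      using q(3)[OF that] g(2)[of "2 * pi * s"] by (simp add: exp_diff)
  qed auto
  then obtain k where k: "\<And>s. s \<in> {0..1} \<Longrightarrow> q s - g (2 * pi * s) = k"
    unfolding constant_on_def by blast
  \<comment> \<open>The logarithms \<open>q\<close> and \<open>g\<close> gain the same amount over one turn, and \<open>q\<close> gains nothing.\<close>
  have g_end: "g (2 * pi) = g 0"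
    using k[of 0] k[of 1] q(2) by (simp add: pathstart_def pathfinish_def algebra_simps)
  have "(\<lambda>t. g (t + 2 * pi) - g t) constant_on UNIV"
  proof (rule constant_if_quantised)
    show "continuous_on UNIV (\<lambda>t. g (t + 2 * pi) - g t)"
      by (intro continuous_intros continuous_on_compose2[OF g(1)]) auto
    show "exp (g (t + 2 * pi) - g t) = 1" for t
      using deriv_periodic[OF c(1,2), of t] g(2)[of t] g(2)[of "t + 2 * pi"]
      by (simp add: exp_diff)
  qed auto
  then have per: "g (t + 2 * pi) = g t" for t
    using g_end unfolding constant_on_def by (metis UNIV_I add_0 eq_iff_diff_eq_0)
  have "tangent_angle c (\<lambda>t. Im (g t))"
    unfolding tangent_angle_def
  proof (intro conjI allI)
    show "continuous_on UNIV (\<lambda>t. Im (g t))"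
      by (intro continuous_intros g(1))
    show "sgn (?c' t) = cis (Im (g t))" for t
      by (simp add: g(2) exp_eq_polar sgn_mult sgn_of_real)
  qed (simp add: per)
  then show thesis ..
qed

lemma tangent_angle_unique:
  assumes a: "tangent_angle c a" and b: "tangent_angle c b"
  obtains k where "cis k = 1" "\<And>t. b t = a t + k"
proof -
  have cis_eq: "cis (b t - a t) = 1" for t
    using a b by (simp add: tangent_angle_def flip: cis_divide)
  have "(\<lambda>t. \<i> * of_real (b t - a t)) constant_on UNIV"
    using a b cis_eq
    by (intro constant_if_quantised) (auto simp: tangent_angle_def cis_conv_exp intro!: continuous_intros)
  then obtain z where z: "\<And>t. \<i> * of_real (b t - a t) = z"
    unfolding constant_on_def by blast
  have "b t - a t = b 0 - a 0" for t
    using z[of t] z[of 0] by (metis complex_i_not_zero mult_cancel_left of_real_eq_iff)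
  then have "b t = a t + (b 0 - a 0)" for t
    by (simp add: algebra_simps)
  with cis_eq[of 0] show thesis ..
qed

section \<open>The highest tangent direction\<close>

text \<open>
  The supremum of an angle is determined by the curve only modulo \<open>2\<pi>\<close>; passing to the unit circle
  removes the ambiguity.  The maximum is used, rather than the value at a point or an integral
  average with respect to the parameter, because it sees only the range of the angle
  and so is blind to reparametrisation.
\<close>

definition top_direction :: "(real \<Rightarrow> complex) \<Rightarrow> complex" where
  "top_direction c = cis (Sup (range (SOME a. tangent_angle c a)))"

lemma tangent_angle_bdd_above: "tangent_angle c a \<Longrightarrow> bdd_above (range a)"
  by (auto simp: tangent_angle_def intro!: compact_range_periodic bounded_imp_bdd_above compact_imp_bounded)

lemma Sup_range_add_const:
  fixes a :: "real \<Rightarrow> real"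
  assumes "bdd_above (range a)"
  shows "Sup (range (\<lambda>t. a t + k)) = Sup (range a) + k"
proof -
  have "continuous (at_left (Sup (range a))) (\<lambda>x. x + k)"
    by (intro continuous_intros)
  then have "Sup (range a) + k = (SUP x\<in>range a. x + k)"
    using assms by (intro continuous_at_Sup_mono) (auto simp: mono_def)
  then show ?thesis
    by (simp add: image_image)
qed

lemma top_direction_eq:
  assumes a: "tangent_angle c a"
  shows "top_direction c = cis (Sup (range a))"
proof -
  have "tangent_angle c (SOME a. tangent_angle c a)"
    using a by (rule someI[where P = "tangent_angle c"])
  then obtain k where k: "cis k = 1" "\<And>t. (SOME a. tangent_angle c a) t = a t + k"
    using tangent_angle_unique[OF a] by blast
  then have "(SOME a. tangent_angle c a) = (\<lambda>t. a t + k)"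
    by auto
  then have "top_direction c = cis (Sup (range a) + k)"
    by (simp add: top_direction_def Sup_range_add_const[OF tangent_angle_bdd_above[OF a]])
  then show ?thesis
    using k(1) by (simp flip: cis_mult)
qed

text \<open>
  The chain rule multiplies the tangent by a positive factor, so \<open>a \<circ> f\<close> is a tangent angle of
  \<open>c \<circ> f\<close>; it has the same range as \<open>a\<close> because \<open>f\<close> is surjective.
\<close>

lemma top_direction_reparam:
  assumes c: "c \<in> Imm0" and f: "f \<in> Diff_plus" and cf: "c \<circ> f \<in> Imm0"
  shows "top_direction (c \<circ> f) = top_direction c"
proof -
  let ?c' = "\<lambda>t. vector_derivative c (at t)" and ?f' = "\<lambda>t. vector_derivative f (at t)"
  obtain a where a: "tangent_angle c a"
    using exists_tangent_angle[OF c] .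
  have f_props: "surj f" "smooth f" "strict_mono f" "\<And>t. f (t + 2 * pi) = f t + 2 * pi"
    using f by (auto simp: Diff_plus_def bij_def)
  have f_deriv: "(f has_vector_derivative ?f' t) (at t)" for t
    using smooth_differentiable[OF f_props(2)] by (simp add: vector_derivative_works)
  have "smooth c"
    using c by (auto simp: Imm0_def immersions_def smooth_loops_def)
  then have chain: "vector_derivative (c \<circ> f) (at t) = ?f' t *\<^sub>R ?c' (f t)" for t
    using f_props(2) by (intro vector_derivative_chain_at smooth_differentiable)
  have pos: "?f' t > 0" for t
  proof -
    have "?f' t \<ge> 0"
      using f_deriv[of t] strict_mono_mono[OF f_props(3)]
      by (intro mono_on_imp_deriv_nonneg[of UNIV f])
        (auto simp: has_real_derivative_iff_has_vector_derivative)
    \<comment> \<open>A zero of \<open>f'\<close> would be a zero of the derivative of the immersion \<open>c \<circ> f\<close>.\<close>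
    moreover have "?f' t \<noteq> 0"
      using cf chain[of t] by (auto simp: Imm0_def immersions_def)
    ultimately show ?thesis
      by simp
  qed
  have "tangent_angle (c \<circ> f) (a \<circ> f)"
    unfolding tangent_angle_def
  proof (intro conjI allI)
    have "continuous_on UNIV f"
      using smooth_differentiable[OF f_props(2)]
      by (simp add: continuous_on_eq_continuous_at differentiable_imp_continuous_within)
    then show "continuous_on UNIV (a \<circ> f)"
      using a by (intro continuous_on_compose) (auto simp: tangent_angle_def elim: continuous_on_subset)
    show "(a \<circ> f) (t + 2 * pi) = (a \<circ> f) t" for t
      using a f_props(4) by (simp add: tangent_angle_def)
    show "sgn (vector_derivative (c \<circ> f) (at t)) = cis ((a \<circ> f) t)" for t
      using a pos[of t] by (simp add: chain tangent_angle_def sgn_scaleR)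
  qed
  then have "top_direction (c \<circ> f) = cis (Sup (range (a \<circ> f)))"
    by (rule top_direction_eq)
  also have "range (a \<circ> f) = range a"
    using f_props(1) by (metis image_comp)
  finally show ?thesis
    by (simp only: top_direction_eq[OF a])
qed

lemma Diff_orbit_refl: "c \<in> Diff_orbit c"
proof -
  have affine: "\<exists>a b. iter_deriv k (\<lambda>t::real. t) = (\<lambda>t. a + b * t)" for k
  proof (induction k)
    case 0
    show ?case by (intro exI[of _ 0] exI[of _ 1]) simp
  next
    case (Suc k)
    then obtain a b where "iter_deriv k (\<lambda>t::real. t) = (\<lambda>t. a + b * t)" by blast
    moreover have "vector_derivative (\<lambda>t. a + b * t) (at t) = b + 0 * t" for t
      by (rule vector_derivative_at) (auto intro!: derivative_eq_intros)
    ultimately have "iter_deriv (Suc k) (\<lambda>t::real. t) = (\<lambda>t. b + 0 * t)"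
      by (simp add: iter_deriv_Suc)
    then show ?case by blast
  qed
  have "iter_deriv k (\<lambda>t::real. t) differentiable (at t)" for k t
  proof -
    obtain a b where "iter_deriv k (\<lambda>t::real. t) = (\<lambda>t. a + b * t)"
      using affine by blast
    then show ?thesis
      by simp
  qed
  then have "smooth (\<lambda>t::real. t)"
    by (simp add: smooth_def)
  then have "id \<in> Diff_plus"
    by (simp add: Diff_plus_def id_def inv_id[unfolded id_def] strict_mono_def bij_id[unfolded id_def])
  then show ?thesis
    unfolding Diff_orbit_def by (auto intro!: exI[of _ id])
qed

lemma top_direction_orbit:
  assumes "c \<in> Imm0" "d \<in> Imm0" "Diff_orbit c = Diff_orbit d"
  shows "top_direction c = top_direction d"
proof -
  obtain f where "f \<in> Diff_plus" "d = c \<circ> f"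
    using Diff_orbit_refl[of d] assms(3) by (auto simp: Diff_orbit_def)
  then show ?thesis
    using top_direction_reparam assms by metis
qed

text \<open>
  As \<open>d' / c'\<close> stays in the unit disc around 1, which avoids the branch cut of \<^const>\<open>Arg\<close>, its
  principal argument is a continuous periodic correction turning an angle of \<open>c\<close> into one of \<open>d\<close>.
\<close>

lemma tangent_angle_perturb:
  assumes a: "tangent_angle c a"
    and d: "d \<in> immersions" and c: "c \<in> immersions"
    and close: "\<And>t. norm (vector_derivative d (at t) / vector_derivative c (at t) - 1) < 1"
  shows "tangent_angle d (\<lambda>t. a t + Arg (vector_derivative d (at t) / vector_derivative c (at t)))"
proof -
  let ?c' = "\<lambda>t. vector_derivative c (at t)" and ?d' = "\<lambda>t. vector_derivative d (at t)"
  have sm: "smooth c" "smooth d" "\<And>t. c (t + 2 * pi) = c t" "\<And>t. d (t + 2 * pi) = d t"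
    and nz: "\<And>t. ?c' t \<noteq> 0" "\<And>t. ?d' t \<noteq> 0"
    using c d by (auto simp: immersions_def smooth_loops_def)
  have slit: "?d' t / ?c' t \<notin> \<real>\<^sub>\<le>\<^sub>0" for t
  proof -
    have "\<bar>Re (?d' t / ?c' t - 1)\<bar> < 1"
      using abs_Re_le_cmod close[of t] by (rule le_less_trans)
    then show ?thesis
      by (auto simp: complex_nonpos_Reals_iff)
  qed
  show ?thesis
    unfolding tangent_angle_def
  proof (intro conjI allI)
    show "continuous_on UNIV (\<lambda>t. a t + Arg (?d' t / ?c' t))"
      using a nz slit smooth_continuous_on_deriv[OF sm(1)] smooth_continuous_on_deriv[OF sm(2)]
      by (intro continuous_intros) (auto simp: tangent_angle_def)
    show "a (t + 2 * pi) + Arg (?d' (t + 2 * pi) / ?c' (t + 2 * pi)) = a t + Arg (?d' t / ?c' t)" for t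
      using a by (simp only: tangent_angle_def deriv_periodic[OF sm(1,3)] deriv_periodic[OF sm(2,4)])
    show "sgn (?d' t) = cis (a t + Arg (?d' t / ?c' t))" for t
    proof -
      have "cis (a t + Arg (?d' t / ?c' t)) = sgn (?c' t) * sgn (?d' t / ?c' t)"
        using a nz by (simp add: tangent_angle_def cis_Arg flip: cis_mult)
      also have "\<dots> = sgn (?c' t * (?d' t / ?c' t))"
        by (rule sgn_mult[symmetric])
      also have "?c' t * (?d' t / ?c' t) = ?d' t"
        using nz by simp
      finally show ?thesis ..
    qed
  qed
qed

lemma Sup_range_close:
  fixes a b :: "'a \<Rightarrow> real"
  assumes "bdd_above (range a)" "bdd_above (range b)" "\<And>t. \<bar>b t - a t\<bar> \<le> e"
  shows "\<bar>Sup (range b) - Sup (range a)\<bar> \<le> e"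
proof -
  have "Sup (range b) \<le> Sup (range a) + e"
  proof (rule cSup_least)
    fix x assume "x \<in> range b"
    then obtain t where "x = b t" by blast
    then show "x \<le> Sup (range a) + e"
      using cSup_upper[OF rangeI assms(1), of t] assms(3)[of t] by linarith
  qed auto
  moreover have "Sup (range a) \<le> Sup (range b) + e"
  proof (rule cSup_least)
    fix x assume "x \<in> range a"
    then obtain t where "x = a t" by blast
    then show "x \<le> Sup (range b) + e"
      using cSup_upper[OF rangeI assms(2), of t] assms(3)[of t] by linarith
  qed auto
  ultimately show ?thesis
    by linarith
qed

text \<open>
  Since \<open>\<bar>c'\<bar>\<close> has a positive minimum \<open>m\<close> by compactness,
  \<open>\<bar>d' - c'\<bar> < m \<eta>\<close> forces \<open>\<bar>d' / c' - 1\<bar> < \<eta>\<close>, and then suitable angles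
  of \<open>c\<close> and \<open>d\<close> are uniformly close, and so are their maxima.
\<close>

lemma top_direction_close:
  assumes c: "c \<in> Imm0" and "\<epsilon> > 0"
  obtains \<delta> where "\<delta> > 0"
    "\<And>d. d \<in> Imm0 \<Longrightarrow> Cinf_close 1 \<delta> c d \<Longrightarrow> dist (top_direction d) (top_direction c) < \<epsilon>"
proof -
  let ?c' = "\<lambda>t. vector_derivative c (at t)"
  obtain a where a: "tangent_angle c a"
    using exists_tangent_angle[OF c] .
  have imm: "c \<in> immersions"
    using c by (simp add: Imm0_def)
  then have sm: "smooth c" "\<And>t. c (t + 2 * pi) = c t" "\<And>t. ?c' t \<noteq> 0"
    by (auto simp: immersions_def smooth_loops_def)
  have "compact (range ?c')"
    by (rule compact_range_periodic[OF smooth_continuous_on_deriv[OF sm(1)] deriv_periodic[OF sm(1,2)]])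
  moreover have "0 \<notin> range ?c'"
    using sm(3) by auto
  ultimately obtain m where m: "m > 0" "\<And>t. m \<le> norm (?c' t)"
    using separate_point_closed[of "range ?c'" 0] by (auto simp: compact_imp_closed)
  have "isCont cis (Sup (range a))"
    unfolding cis_conv_exp by (intro continuous_intros)
  then obtain \<alpha> where \<alpha>: "\<alpha> > 0"
    "\<And>y. dist y (Sup (range a)) < \<alpha> \<Longrightarrow> dist (cis y) (cis (Sup (range a))) < \<epsilon>"
    using \<open>\<epsilon> > 0\<close> unfolding continuous_at_eps_delta by blast
  have "isCont Arg 1"
    by (rule continuous_at_Arg) auto
  then obtain \<eta> where \<eta>: "\<eta> > 0" "\<And>z. dist z 1 < \<eta> \<Longrightarrow> \<bar>Arg z\<bar> < \<alpha> / 2"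
    using \<alpha>(1) unfolding continuous_at_eps_delta by (metis Arg_1 dist_real_def diff_zero half_gt_zero)
  define \<delta> where "\<delta> = m * min \<eta> 1"
  have "dist (top_direction d) (top_direction c) < \<epsilon>" if d: "d \<in> Imm0" "Cinf_close 1 \<delta> c d" for d
  proof -
    let ?d' = "\<lambda>t. vector_derivative d (at t)"
    have quot: "norm (?d' t / ?c' t - 1) < min \<eta> 1" for t
    proof -
      have "norm (iter_deriv 1 d t - iter_deriv 1 c t) < \<delta>"
        using d(2) by (simp add: Cinf_close_def)
      then have "norm (?d' t - ?c' t) < m * min \<eta> 1"
        by (simp add: iter_deriv_Suc \<delta>_def)
      also have "\<dots> \<le> norm (?c' t) * min \<eta> 1"
        using m(2)[of t] \<eta>(1) by (intro mult_right_mono) auto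
      finally have "norm (?d' t - ?c' t) / norm (?c' t) < min \<eta> 1"
        using sm(3)[of t] by (simp add: pos_divide_less_eq mult.commute del: min_less_iff_conj)
      moreover have "?d' t / ?c' t - 1 = (?d' t - ?c' t) / ?c' t"
        using sm(3)[of t] by (simp add: diff_divide_distrib)
      ultimately show ?thesis
        by (simp add: norm_divide)
    qed
    let ?b = "\<lambda>t. a t + Arg (?d' t / ?c' t)"
    have b: "tangent_angle d ?b"
      using quot d(1) imm by (intro tangent_angle_perturb a) (auto simp: Imm0_def)
    have "\<bar>?b t - a t\<bar> \<le> \<alpha> / 2" for t
      using \<eta>(2)[of "?d' t / ?c' t"] quot[of t] by (simp add: dist_norm)
    then have "\<bar>Sup (range ?b) - Sup (range a)\<bar> \<le> \<alpha> / 2"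
      by (intro Sup_range_close tangent_angle_bdd_above[OF a] tangent_angle_bdd_above[OF b])
    then show ?thesis
      using \<alpha> by (simp add: top_direction_eq[OF a] top_direction_eq[OF b] dist_real_def)
  qed
  moreover have "\<delta> > 0"
    using m(1) \<eta>(1) by (simp add: \<delta>_def)
  ultimately show thesis
    using that by blast
qed

lemma Cinf_close_triangle:
  assumes "Cinf_close n \<delta> c d" "Cinf_close n \<epsilon> d e"
  shows "Cinf_close n (\<delta> + \<epsilon>) c e"
  unfolding Cinf_close_def
proof (intro allI impI)
  fix k t assume "k \<le> n"
  then have "norm (iter_deriv k d t - iter_deriv k c t) < \<delta>" "norm (iter_deriv k e t - iter_deriv k d t) < \<epsilon>"
    using assms by (auto simp: Cinf_close_def)
  then show "norm (iter_deriv k e t - iter_deriv k c t) < \<delta> + \<epsilon>"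
    using norm_triangle_lt[of "iter_deriv k d t - iter_deriv k c t" "iter_deriv k e t - iter_deriv k d t"]
    by simp
qed

text \<open>
  Openness in a subspace can be tested with nearby points of the subspace only.  The
  open set of the ambient space that is needed is \<open>T\<close>, the interior of the set of loops that satisfy
  \<open>P\<close> or lie outside \<open>S\<close>.
\<close>

lemma openin_subtopology_Cinf:
  assumes "S \<subseteq> smooth_loops"
    and near: "\<And>c. c \<in> S \<Longrightarrow> P c \<Longrightarrow> \<exists>n. \<exists>\<epsilon>>0. \<forall>d\<in>S. Cinf_close n \<epsilon> c d \<longrightarrow> P d"
  shows "openin (subtopology Cinf_topology S) {c \<in> S. P c}"
proof -
  define T where "T = {c \<in> smooth_loops. \<exists>n. \<exists>\<epsilon>>0. \<forall>d\<in>S. Cinf_close n \<epsilon> c d \<longrightarrow> P d}"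
  have "openin Cinf_topology T"
    unfolding openin_Cinf_topology
  proof (intro conjI ballI)
    fix c assume "c \<in> T"
    then obtain n \<epsilon> where e: "\<epsilon> > 0" "\<And>d. d \<in> S \<Longrightarrow> Cinf_close n \<epsilon> c d \<Longrightarrow> P d"
      unfolding T_def by blast
    have "d \<in> T" if "d \<in> smooth_loops" "Cinf_close n (\<epsilon> / 2) c d" for d
      unfolding T_def
      using that e Cinf_close_triangle[OF that(2), of "\<epsilon> / 2"]
      by (auto intro!: exI[of _ n] exI[of _ "\<epsilon> / 2"])
    then show "\<exists>n. \<exists>\<epsilon>>0. \<forall>d\<in>smooth_loops. Cinf_close n \<epsilon> c d \<longrightarrow> d \<in> T"
      using e(1) by (intro exI[of _ n] exI[of _ "\<epsilon> / 2"]) simp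
  qed (auto simp: T_def)
  moreover have "{c \<in> S. P c} = T \<inter> S"
  proof
    show "{c \<in> S. P c} \<subseteq> T \<inter> S"
      using assms unfolding T_def by blast
    show "T \<inter> S \<subseteq> {c \<in> S. P c}"
      by (auto simp: T_def Cinf_close_def)
  qed
  ultimately show ?thesis
    unfolding openin_subtopology by blast
qed

lemma Imm0_subset_smooth_loops: "Imm0 \<subseteq> smooth_loops"
  by (auto simp: Imm0_def immersions_def)

lemma topspace_Imm0_topology [simp]: "topspace Imm0_topology = Imm0"
  using Imm0_subset_smooth_loops by (auto simp: Imm0_topology_def)

lemma continuous_top_direction:
  "continuous_map Imm0_topology (top_of_set (sphere 0 1)) top_direction"
  unfolding continuous_map_in_subtopology
proof
  show "continuous_map Imm0_topology euclidean top_direction"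
    unfolding continuous_map_def
  proof (intro conjI allI impI)
    fix U :: "complex set"
    assume "openin euclidean U"
    then have U: "open U" by simp
    show "openin Imm0_topology {c \<in> topspace Imm0_topology. top_direction c \<in> U}"
      unfolding topspace_Imm0_topology unfolding Imm0_topology_def
    proof (rule openin_subtopology_Cinf[OF Imm0_subset_smooth_loops])
      fix c assume c: "c \<in> Imm0" "top_direction c \<in> U"
      then obtain \<epsilon> where e: "\<epsilon> > 0" "\<And>z. dist z (top_direction c) < \<epsilon> \<Longrightarrow> z \<in> U"
        using U unfolding open_dist by blast
      then show "\<exists>n. \<exists>\<epsilon>>0. \<forall>d\<in>Imm0. Cinf_close n \<epsilon> c d \<longrightarrow> top_direction d \<in> U"
        using top_direction_close[OF c(1) e(1)] by metis
    qed
  qed auto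
  show "top_direction \<in> topspace Imm0_topology \<rightarrow> sphere 0 1"
    by (auto simp: top_direction_def)
qed

section \<open>The circle of rotated figure eights\<close>

definition figure_eight :: "complex \<Rightarrow> real \<Rightarrow> complex" where
  "figure_eight w t = w * Complex (sin t) (sin (2 * t))"

text \<open>
  The \<open>k\<close>-th derivative of the figure eight: each differentiation advances the phases by \<open>\<pi>/2\<close> and
  doubles the second coordinate.
\<close>

definition shifted_eight :: "complex \<Rightarrow> nat \<Rightarrow> real \<Rightarrow> complex" where
  "shifted_eight w k t = w * Complex (sin (t + k * pi / 2)) (2 ^ k * sin (2 * t + k * pi / 2))"

lemma has_vector_derivative_shifted_eight:
  "(shifted_eight w k has_vector_derivative shifted_eight w (Suc k) t) (at t)"
proof -
  have shift: "sin (x + Suc k * pi / 2) = cos (x + k * pi / 2)" for x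
  proof -
    have "sin (x + Suc k * pi / 2) = sin ((x + k * pi / 2) + pi / 2)"
      by (simp add: field_simps)
    then show ?thesis
      by (simp only: sin_add) simp
  qed
  have "((\<lambda>t. w * Complex (sin (t + k * pi / 2)) (2 ^ k * sin (2 * t + k * pi / 2)))
      has_vector_derivative
        w * Complex (cos (t + k * pi / 2)) (2 ^ k * (cos (2 * t + k * pi / 2) * 2))) (at t)"
    by (intro has_vector_derivative_mult_right has_vector_derivative_complex_iff[THEN iffD2])
      (auto intro!: derivative_eq_intros)
  then show ?thesis
    unfolding shifted_eight_def shift by (simp add: mult_ac)
qed

lemma iter_deriv_figure_eight: "iter_deriv k (figure_eight w) = shifted_eight w k"
proof (induction k)
  case 0
  show ?case
    by (simp add: figure_eight_def shifted_eight_def fun_eq_iff)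
next
  case (Suc k)
  show ?case
    unfolding iter_deriv_Suc Suc.IH
    by (intro ext vector_derivative_at has_vector_derivative_shifted_eight)
qed

lemma deriv_figure_eight:
  "vector_derivative (figure_eight w) (at t) = w * Complex (cos t) (2 * cos (2 * t))"
  using fun_cong[OF iter_deriv_figure_eight[of 1 w], of t]
  by (simp add: iter_deriv_Suc shifted_eight_def sin_add)

text \<open>
  The derivative of the figure eight is an even function, so its path is unchanged by reversal.
  Reversal negates winding numbers, so the degree is 0.
\<close>

lemma figure_eight_in_Imm0:
  assumes "w \<noteq> 0"
  shows "figure_eight w \<in> Imm0"
proof -
  let ?p = "\<lambda>s. vector_derivative (figure_eight w) (at (2 * pi * s))"
  have "iter_deriv k (figure_eight w) differentiable (at t)" for k t
    unfolding iter_deriv_figure_eight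
    by (rule differentiableI_vector[OF has_vector_derivative_shifted_eight])
  moreover have "figure_eight w (t + 2 * pi) = figure_eight w t" for t
    using sin_cos_eq_iff[of "2 * t + 2 * (2 * pi)" "2 * t"]
    by (simp add: figure_eight_def distrib_left)
  ultimately have loop: "figure_eight w \<in> smooth_loops"
    by (simp add: smooth_loops_def smooth_def)
  have nz: "vector_derivative (figure_eight w) (at t) \<noteq> 0" for t
  proof -
    have "Complex (cos t) (2 * cos (2 * t)) \<noteq> 0"
      by (auto simp: complex_eq_iff cos_double_cos)
    then show ?thesis
      using assms by (simp add: deriv_figure_eight)
  qed
  have p: "path ?p"
    unfolding path_def deriv_figure_eight Complex_eq by (intro continuous_intros)
  have p_nz: "0 \<notin> path_image ?p"
  proof
    assume "0 \<in> path_image ?p"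
    then obtain s where "0 = ?p s"
      unfolding path_image_def by (elim imageE)
    then show False
      using nz[of "2 * pi * s"] by simp
  qed
  have "reversepath ?p = ?p"
  proof
    fix s
    have "cos (2 * pi * (1 - s)) = cos (2 * pi * s)" "cos (2 * (2 * pi * (1 - s))) = cos (2 * (2 * pi * s))"
      by (simp_all add: algebra_simps cos_diff)
    then show "reversepath ?p s = ?p s"
      by (simp add: reversepath_def deriv_figure_eight)
  qed
  then have "winding_number ?p 0 = - winding_number ?p 0"
    using winding_number_reversepath[OF p p_nz] by simp
  then have "rotation_degree (figure_eight w) = 0"
    by (simp add: rotation_degree_def)
  then show ?thesis
    using loop nz by (simp add: Imm0_def immersions_def)
qed

text \<open>
  The derivatives depend linearly on \<open>w\<close>, and those of order at most \<open>n\<close> are bounded by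
  \<open>(1 + 2\<^sup>n) \<bar>w\<bar>\<close>.
\<close>

lemma continuous_figure_eight:
  "continuous_map (top_of_set (sphere 0 1)) Imm0_topology figure_eight"
  unfolding Imm0_topology_def continuous_map_in_subtopology
proof
  show "figure_eight \<in> topspace (top_of_set (sphere 0 1)) \<rightarrow> Imm0"
    by (auto intro!: figure_eight_in_Imm0)
  show "continuous_map (top_of_set (sphere 0 1)) Cinf_topology figure_eight"
    unfolding continuous_map_def
  proof (intro conjI allI impI)
    show "figure_eight \<in> topspace (top_of_set (sphere 0 1)) \<rightarrow> topspace Cinf_topology"
      by (auto intro!: subsetD[OF Imm0_subset_smooth_loops] figure_eight_in_Imm0)
  next
    fix U assume U: "openin Cinf_topology U"
    let ?S = "{w \<in> sphere 0 1. figure_eight w \<in> U}"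
    have "\<exists>\<delta>>0. \<forall>w'\<in>sphere 0 1. dist w' w < \<delta> \<longrightarrow> w' \<in> ?S" if "w \<in> ?S" for w
    proof -
      obtain n \<epsilon> where e: "\<epsilon> > 0"
        "\<And>d. d \<in> smooth_loops \<Longrightarrow> Cinf_close n \<epsilon> (figure_eight w) d \<Longrightarrow> d \<in> U"
        using U \<open>w \<in> ?S\<close> unfolding openin_Cinf_topology by blast
      define \<delta> where "\<delta> = \<epsilon> / (1 + 2 ^ n)"
      have "w' \<in> ?S" if w': "w' \<in> sphere 0 1" "dist w' w < \<delta>" for w'
      proof -
        have "Cinf_close n \<epsilon> (figure_eight w) (figure_eight w')"
          unfolding Cinf_close_def
        proof (intro allI impI)
          fix k t assume "k \<le> n"
          let ?z = "Complex (sin (t + k * pi / 2)) (2 ^ k * sin (2 * t + k * pi / 2))"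
          have "norm ?z \<le> \<bar>Re ?z\<bar> + \<bar>Im ?z\<bar>"
            by (rule cmod_le)
          also have "\<dots> \<le> 1 + 2 ^ k * 1"
            unfolding complex.sel abs_mult by (intro add_mono mult_mono) auto
          also have "\<dots> \<le> 1 + 2 ^ n"
            using \<open>k \<le> n\<close> by simp
          finally have "norm (w' - w) * norm ?z \<le> norm (w' - w) * (1 + 2 ^ n)"
            by (rule mult_left_mono) simp
          also have "\<dots> < \<epsilon>"
            using w'(2) by (simp add: \<delta>_def dist_norm pos_less_divide_eq add_pos_pos)
          finally show "norm (iter_deriv k (figure_eight w') t - iter_deriv k (figure_eight w) t) < \<epsilon>"
            unfolding iter_deriv_figure_eight shifted_eight_def left_diff_distrib[symmetric] norm_mult .
        qed
        moreover have "figure_eight w' \<in> smooth_loops"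
          using w'(1) by (intro subsetD[OF Imm0_subset_smooth_loops] figure_eight_in_Imm0) auto
        ultimately show ?thesis
          using e(2) w'(1) by blast
      qed
      moreover have "\<delta> > 0"
        using e(1) by (simp add: \<delta>_def add_pos_pos)
      ultimately show ?thesis
        by blast
    qed
    then have "openin (top_of_set (sphere 0 1)) ?S"
      unfolding openin_euclidean_subtopology_iff by blast
    then show "openin (top_of_set (sphere 0 1)) {w \<in> topspace (top_of_set (sphere 0 1)). figure_eight w \<in> U}"
      by simp
  qed
qed

lemma top_direction_figure_eight:
  assumes "norm w = 1"
  shows "top_direction (figure_eight w) = w * top_direction (figure_eight 1)"
proof -
  obtain a where a: "tangent_angle (figure_eight 1) a"
    using exists_tangent_angle[OF figure_eight_in_Imm0[OF one_neq_zero]] .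
  have w: "w = cis (Arg w)"
    using cis_Arg[of w] assms by (cases "w = 0") (simp_all add: sgn_div_norm)
  have sgn_w: "sgn w = w"
    using assms by (simp add: sgn_div_norm)
  have "sgn (vector_derivative (figure_eight w) (at t)) = cis (a t + Arg w)" for t
  proof -
    have "sgn (vector_derivative (figure_eight w) (at t))
        = sgn w * sgn (vector_derivative (figure_eight 1) (at t))"
      by (simp add: deriv_figure_eight sgn_mult)
    also have "\<dots> = cis (Arg w) * cis (a t)"
      using a by (simp add: tangent_angle_def sgn_w flip: w)
    finally show ?thesis
      by (simp add: cis_mult add.commute)
  qed
  then have "tangent_angle (figure_eight w) (\<lambda>t. a t + Arg w)"
    using a by (auto simp: tangent_angle_def intro!: continuous_intros)
  then have "top_direction (figure_eight w) = cis (Sup (range a) + Arg w)"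
    using top_direction_eq Sup_range_add_const[OF tangent_angle_bdd_above[OF a]] by metis
  also have "\<dots> = w * top_direction (figure_eight 1)"
    using w top_direction_eq[OF a] by (metis cis_mult mult.commute)
  finally show ?thesis .
qed

section \<open>The circle as a retract of the quotient\<close>

theorem proposition2p1:
  shows "\<not> contractible_space (quotient_topology Imm0_topology Diff_orbit)"
proof
  let ?Q = "quotient_topology Imm0_topology Diff_orbit" and ?S = "top_of_set (sphere (0::complex) 1)"
  assume contr: "contractible_space ?Q"
  obtain G where G: "continuous_map ?Q ?S G" "\<And>c. c \<in> Imm0 \<Longrightarrow> G (Diff_orbit c) = top_direction c"
    using quotient_map_lift_exists[OF quotient_map_quotient_topology continuous_top_direction]
      top_direction_orbit by (metis topspace_Imm0_topology)
  define u where "u = top_direction (figure_eight 1)"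
  have u: "norm u = 1"
    by (simp add: u_def top_direction_def)
  \<comment> \<open>Dividing by \<open>u\<close> makes the section hit the right fibre: figure eight \<open>w / u\<close> has top direction \<open>w\<close>.\<close>
  define section_map where "section_map = (\<lambda>w. Diff_orbit (figure_eight (w / u)))"
  have "continuous_map ?S ?S (\<lambda>w. w / u)"
    using u by (auto simp: norm_divide intro!: continuous_intros)
  then have "continuous_map ?S ?Q (Diff_orbit \<circ> (figure_eight \<circ> (\<lambda>w. w / u)))"
    by (intro continuous_map_compose[OF continuous_map_compose[OF _ continuous_figure_eight]]
        quotient_imp_continuous_map[OF quotient_map_quotient_topology])
  then have "continuous_map ?S ?Q section_map"
    by (simp add: section_map_def o_def)
  moreover have "G (section_map w) = w" if "w \<in> sphere 0 1" for w
  proof -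
    have w: "norm (w / u) = 1"
      using that u by (simp add: norm_divide)
    then have "figure_eight (w / u) \<in> Imm0"
      by (intro figure_eight_in_Imm0) auto
    then have "G (section_map w) = top_direction (figure_eight (w / u))"
      by (simp add: section_map_def G(2))
    also have "\<dots> = (w / u) * u"
      by (subst top_direction_figure_eight[OF w]) (simp only: u_def)
    also have "\<dots> = w"
      using u by auto
    finally show ?thesis .
  qed
  ultimately have "retraction_map ?Q ?S G"
    using G(1) unfolding retraction_map_def retraction_maps_def by auto
  then have "contractible_space ?S"
    using contr by (rule contractible_space_retraction_map_image)
  then show False
    by (simp add: contractible_sphere)
qed

end
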